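(* The logic sBIL does not satisfy the Deduction-Detachment Theorem: there is no set $I(p,q)$ of formulas in at most the two variables $p,q$ such that for all sets of formulas $\Gamma$ and formulas $\phi,\psi$, $\Gamma\cup\{\phi\}\vdash_s\psi$ iff $\Gamma\vdash_s I(\phi,\psi)$.
   Context: Fix a countably infinite set $\mathrm{Prop}$ of propositional variables. Bi-intuitionistic formulas are generated by $\phi ::= p \mid \bot \mid \top \mid \phi\wedge\phi \mid \phi\vee\phi \mid \phi\to\phi \mid \phi\prec\phi$ with $p\in\mathrm{Prop}$ ($\prec$ is exclusion). Abbreviations: $\neg\phi := \phi\to\bot$, ${\sim}\phi := \top\prec\phi$. An axiom is any instance of: (A1) $\phi\to(\psi\to\phi)$; (A2) $(\phi\to(\psi\to\chi))\to((\phi\to\psi)\to(\phi\to\chi))$; (A3) $\phi\to(\phi\vee\psi)$; (A4) $\psi\to(\phi\vee\psi)$; (A5) $(\phi\to\chi)\to((\psi\to\chi)\to((\phi\vee\psi)\to\chi))$; (A6) $(\phi\wedge\psi)\to\phi$; (A7) $(\phi\wedge\psi)\to\psi$; (A8) $(\chi\to\phi)\to((\chi\to\psi)\to(\chi\to(\phi\wedge\psi)))$; (A9) $\bot\to\phi$; (A10) $\phi\to\top$; (A11) $\phi\to(\psi\vee(\phi\prec\psi))$; (A12) $(\phi\prec\psi)\to{\sim}(\phi\to\psi)$; (A13) $((\phi\prec\psi)\prec\chi)\to(\phi\prec(\psi\vee\chi))$; (A14) $\neg(\phi\prec\psi)\to(\phi\to\psi)$. sBIL is the relation $\Gamma\vdash_s\phi$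 holding iff $\Gamma\vdash\phi$ is derivable with: (Ax) $\Gamma\vdash\phi$ for any axiom $\phi$; (El) $\Gamma\vdash\phi$ if $\phi\in\Gamma$; (MP) from $\Gamma\vdash\phi$ and $\Gamma\vdash\phi\to\psi$ infer $\Gamma\vdash\psi$; (sDN) from $\Gamma\vdash\phi$ infer $\Gamma\vdash\neg{\sim}\phi$. $I(\phi,\psi)$ is $I(p,q)$ with $p,q$ replaced by $\phi,\psi$; $\Gamma\vdash_s I(\phi,\psi)$ means $\Gamma$ derives every member. *)

theory Defs
  imports Main "HOL-Library.Countable" "HOL-Library.Infinite_Typeclass"
begin

datatype (vars: 'v) fm =
    Var 'v
  | Bot  (\<open>\<^bold>\<bottom>\<close>)
  | Top  (\<open>\<^bold>\<top>\<close>)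
  | And "'v fm" "'v fm"  (infixr \<open>\<^bold>\<and>\<close> 65)
  | Or "'v fm" "'v fm"  (infixr \<open>\<^bold>\<or>\<close> 60)
  | Imp "'v fm" "'v fm"  (infixr \<open>\<^bold>\<rightarrow>\<close> 55)
  | Excl "'v fm" "'v fm"  (infixl \<open>\<^bold>\<prec>\<close> 55)

abbreviation Neg :: "'v fm \<Rightarrow> 'v fm"  (\<open>\<^bold>\<not> _\<close> [70] 70) where
  "\<^bold>\<not> \<phi> \<equiv> \<phi> \<^bold>\<rightarrow> \<^bold>\<bottom>"

abbreviation WNeg :: "'v fm \<Rightarrow> 'v fm"  (\<open>\<^bold>\<sim> _\<close> [70] 70) where
  "\<^bold>\<sim> \<phi> \<equiv> \<^bold>\<top> \<^bold>\<prec> \<phi>"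

inductive axm :: "'v fm \<Rightarrow> bool" where
  A1: "axm (\<phi> \<^bold>\<rightarrow> (\<psi> \<^bold>\<rightarrow> \<phi>))"
| A2: "axm ((\<phi> \<^bold>\<rightarrow> (\<psi> \<^bold>\<rightarrow> \<chi>)) \<^bold>\<rightarrow> ((\<phi> \<^bold>\<rightarrow> \<psi>) \<^bold>\<rightarrow> (\<phi> \<^bold>\<rightarrow> \<chi>)))"
| A3: "axm (\<phi> \<^bold>\<rightarrow> (\<phi> \<^bold>\<or> \<psi>))"
| A4: "axm (\<psi> \<^bold>\<rightarrow> (\<phi> \<^bold>\<or> \<psi>))"
| A5: "axm ((\<phi> \<^bold>\<rightarrow> \<chi>) \<^bold>\<rightarrow> ((\<psi> \<^bold>\<rightarrow> \<chi>) \<^bold>\<rightarrow> ((\<phi> \<^bold>\<or> \<psi>) \<^bold>\<rightarrow> \<chi>)))"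
| A6: "axm ((\<phi> \<^bold>\<and> \<psi>) \<^bold>\<rightarrow> \<phi>)"
| A7: "axm ((\<phi> \<^bold>\<and> \<psi>) \<^bold>\<rightarrow> \<psi>)"
| A8: "axm ((\<chi> \<^bold>\<rightarrow> \<phi>) \<^bold>\<rightarrow> ((\<chi> \<^bold>\<rightarrow> \<psi>) \<^bold>\<rightarrow> (\<chi> \<^bold>\<rightarrow> (\<phi> \<^bold>\<and> \<psi>))))"
| A9: "axm (\<^bold>\<bottom> \<^bold>\<rightarrow> \<phi>)"
| A10: "axm (\<phi> \<^bold>\<rightarrow> \<^bold>\<top>)"
| A11: "axm (\<phi> \<^bold>\<rightarrow> (\<psi> \<^bold>\<or> (\<phi> \<^bold>\<prec> \<psi>)))"
| A12: "axm ((\<phi> \<^bold>\<prec> \<psi>) \<^bold>\<rightarrow> \<^bold>\<sim> (\<phi> \<^bold>\<rightarrow> \<psi>))"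
| A13: "axm (((\<phi> \<^bold>\<prec> \<psi>) \<^bold>\<prec> \<chi>) \<^bold>\<rightarrow> (\<phi> \<^bold>\<prec> (\<psi> \<^bold>\<or> \<chi>)))"
| A14: "axm (\<^bold>\<not> (\<phi> \<^bold>\<prec> \<psi>) \<^bold>\<rightarrow> (\<phi> \<^bold>\<rightarrow> \<psi>))"

inductive sBIL :: "'v fm set \<Rightarrow> 'v fm \<Rightarrow> bool"  (infix \<open>\<turnstile>\<^sub>s\<close> 50) for \<Gamma> :: "'v fm set" where
  Ax: "axm \<phi> \<Longrightarrow> \<Gamma> \<turnstile>\<^sub>s \<phi>"
| El: "\<phi> \<in> \<Gamma> \<Longrightarrow> \<Gamma> \<turnstile>\<^sub>s \<phi>"
| MP: "\<Gamma> \<turnstile>\<^sub>s \<phi> \<Longrightarrow> \<Gamma> \<turnstile>\<^sub>s \<phi> \<^bold>\<rightarrow> \<psi> \<Longrightarrow> \<Gamma> \<turnstile>\<^sub>s \<psi>"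
| sDN: "\<Gamma> \<turnstile>\<^sub>s \<phi> \<Longrightarrow> \<Gamma> \<turnstile>\<^sub>s \<^bold>\<not> \<^bold>\<sim> \<phi>"

primrec subst :: "('v \<Rightarrow> 'v fm) \<Rightarrow> 'v fm \<Rightarrow> 'v fm" where
  "subst \<sigma> (Var x) = \<sigma> x"
| "subst \<sigma> \<^bold>\<bottom> = \<^bold>\<bottom>"
| "subst \<sigma> \<^bold>\<top> = \<^bold>\<top>"
| "subst \<sigma> (\<phi> \<^bold>\<and> \<psi>) = subst \<sigma> \<phi> \<^bold>\<and> subst \<sigma> \<psi>"
| "subst \<sigma> (\<phi> \<^bold>\<or> \<psi>) = subst \<sigma> \<phi> \<^bold>\<or> subst \<sigma> \<psi>"
| "subst \<sigma> (\<phi> \<^bold>\<rightarrow> \<psi>) = subst \<sigma> \<phi> \<^bold>\<rightarrow> subst \<sigma> \<psi>"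
| "subst \<sigma> (\<phi> \<^bold>\<prec> \<psi>) = subst \<sigma> \<phi> \<^bold>\<prec> subst \<sigma> \<psi>"

end

theory Submission
  imports Defs
begin

text \<open>
  In Kripke semantics a derivation whose rule (sDN) is nested at most \<open>n\<close> deep is local: the
  conclusion holds at a point as soon as the premises hold at all points within zigzag distance
  \<open>2n\<close>. Given a set \<open>I\<close> as in the theorem, detachment \<open>I(p,q), p \<turnstile>\<^sub>s q\<close> is thus local with
  some fixed radius. On the other hand \<open>p \<turnstile>\<^sub>s (\<not>\<sim>)\<^sup>m p\<close> for every \<open>m\<close>, so \<open>I(p, (\<not>\<sim>)\<^sup>m p)\<close>
  consists of theorems. Interpreting \<open>q\<close> as \<open>(\<not>\<sim>)\<^sup>m p\<close> on an infinite fence then shows that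
  \<open>p\<close> on a ball of the fixed radius forces \<open>(\<not>\<sim>)\<^sup>m p\<close> at its centre, which fails for large \<open>m\<close>.
\<close>

primrec sat :: "('w \<Rightarrow> 'w \<Rightarrow> bool) \<Rightarrow> ('v \<Rightarrow> 'w \<Rightarrow> bool) \<Rightarrow> 'w \<Rightarrow> 'v fm \<Rightarrow> bool" where
  "sat R V w (Var x) \<longleftrightarrow> V x w"
| "sat R V w \<^bold>\<bottom> \<longleftrightarrow> False"
| "sat R V w \<^bold>\<top> \<longleftrightarrow> True"
| "sat R V w (\<phi> \<^bold>\<and> \<psi>) \<longleftrightarrow> sat R V w \<phi> \<and> sat R V w \<psi>"
| "sat R V w (\<phi> \<^bold>\<or> \<psi>) \<longleftrightarrow> sat R V w \<phi> \<or> sat R V w \<psi>"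
| "sat R V w (\<phi> \<^bold>\<rightarrow> \<psi>) \<longleftrightarrow> (\<forall>v. R w v \<longrightarrow> sat R V v \<phi> \<longrightarrow> sat R V v \<psi>)"
| "sat R V w (\<phi> \<^bold>\<prec> \<psi>) \<longleftrightarrow> (\<exists>v. R v w \<and> sat R V v \<phi> \<and> \<not> sat R V v \<psi>)"

definition persistent :: "('w \<Rightarrow> 'w \<Rightarrow> bool) \<Rightarrow> ('v \<Rightarrow> 'w \<Rightarrow> bool) \<Rightarrow> bool" where
  "persistent R V \<longleftrightarrow> (\<forall>x w v. R w v \<longrightarrow> V x w \<longrightarrow> V x v)"

text \<open>Going up the order leaves fewer successors to check for an implication and more
  predecessors to witness an exclusion.\<close>

lemma sat_persistent:
  assumes "transp R" "persistent R V" "R w v" "sat R V w \<phi>"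
  shows "sat R V v \<phi>"
  using assms(3,4)
proof (induction \<phi> arbitrary: w v)
  case (Var x)
  then show ?case using assms(2) by (auto simp: persistent_def)
next
  case (Imp \<phi> \<psi>)
  then show ?case unfolding sat.simps by (meson transpD[OF assms(1)])
next
  case (Excl \<phi> \<psi>)
  then show ?case unfolding sat.simps by (meson transpD[OF assms(1)])
qed auto

lemma sat_axm:
  assumes "axm \<phi>" and R: "reflp R" "transp R" and V: "persistent R V"
  shows "sat R V w \<phi>"
proof -
  note refl = reflpD[OF R(1)] and trans = transpD[OF R(2)] and pers = sat_persistent[OF R(2) V]
  show ?thesis
    using assms(1)
  proof cases
    case (A1 \<phi> \<psi>)
    then show ?thesis using pers by auto
  next
    case (A2 \<phi> \<psi> \<chi>)
    show ?thesis unfolding A2 sat.simps by (meson refl trans)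
  next
    case (A5 \<phi> \<chi> \<psi>)
    show ?thesis unfolding A5 sat.simps by (meson refl trans)
  next
    case (A8 \<chi> \<phi> \<psi>)
    show ?thesis unfolding A8 sat.simps by (meson refl trans)
  next
    case (A11 \<phi> \<psi>)
    then show ?thesis using refl by auto
  next
    case (A12 \<phi> \<psi>)
    then show ?thesis using refl by auto
  next
    case (A13 \<phi> \<psi> \<chi>)
    show ?thesis unfolding A13 sat.simps by (meson trans pers)
  next
    case (A14 \<phi> \<psi>)
    then show ?thesis using refl by auto
  qed auto
qed

lemma sat_subst:
  "sat R V w (subst \<sigma> \<phi>) \<longleftrightarrow> sat R (\<lambda>x v. sat R V v (\<sigma> x)) w \<phi>"
  by (induction \<phi> arbitrary: w) auto

lemma persistent_subst:
  "transp R \<Longrightarrow> persistent R V \<Longrightarrow> persistent R (\<lambda>x v. sat R V v (\<sigma> x))"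
  unfolding persistent_def[of R "\<lambda>x v. sat R V v (\<sigma> x)"] by (blast intro: sat_persistent)

text \<open>The zigzag order 0 < 1 > 2 < 3 > ..., with even points minimal and odd points maximal.
  Zigzag distance is the difference of the numbers.\<close>

definition fence :: "nat \<Rightarrow> nat \<Rightarrow> bool" where
  "fence i j \<longleftrightarrow> i = j \<or> even i \<and> (j = i + 1 \<or> i = j + 1)"

lemma reflp_fence: "reflp fence"
  by (simp add: reflp_def fence_def)

lemma transp_fence: "transp fence"
  by (auto simp: transp_def fence_def)

lemma fence_dist: "fence i j \<Longrightarrow> i \<le> j + 1 \<and> j \<le> i + 1"
  by (auto simp: fence_def)

text \<open>The radius is read off the derivation, so it is chosen before the valuation and the
  point. Only (sDN) makes the evaluation leave the point.\<close>

lemma sBIL_local_on_fence: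
  fixes \<Gamma> :: "'v fm set"
  assumes "\<Gamma> \<turnstile>\<^sub>s \<phi>"
  shows "\<exists>n. \<forall>V w. persistent fence V \<longrightarrow>
    (\<forall>\<gamma> \<in> \<Gamma>. \<forall>v. v \<le> w + n \<longrightarrow> w \<le> v + n \<longrightarrow> sat fence V v \<gamma>) \<longrightarrow> sat fence V w \<phi>"
    (is "\<exists>n. ?local n \<phi>")
  using assms
proof induction
  case (Ax \<phi>)
  then show ?case using sat_axm[OF _ reflp_fence transp_fence] by blast
next
  case (El \<phi>)
  then have "?local 0 \<phi>" by auto
  then show ?case ..
next
  case (MP \<phi> \<psi>)
  then obtain m n where m: "?local m \<phi>" and n: "?local n (\<phi> \<^bold>\<rightarrow> \<psi>)" by blast
  \<comment> \<open>Both premises are evaluated at the same point, so any common bound of the two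
    radii works.\<close>
  have "?local (m + n) \<psi>"
  proof (intro allI impI)
    fix V :: "'v \<Rightarrow> nat \<Rightarrow> bool" and w
    assume V: "persistent fence V"
      and \<Gamma>: "\<forall>\<gamma>\<in>\<Gamma>. \<forall>v. v \<le> w + (m + n) \<longrightarrow> w \<le> v + (m + n) \<longrightarrow> sat fence V v \<gamma>"
    have "sat fence V w \<phi>"
      by (intro m[rule_format, OF V] \<Gamma>[rule_format]) simp_all
    moreover have "sat fence V w (\<phi> \<^bold>\<rightarrow> \<psi>)"
      by (intro n[rule_format, OF V] \<Gamma>[rule_format]) simp_all
    ultimately show "sat fence V w \<psi>"
      using reflpD[OF reflp_fence] by simp
  qed
  then show ?case ..
next
  case (sDN \<phi>)
  then obtain n where n: "?local n \<phi>" by blast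
  have "?local (n + 2) (\<^bold>\<not> \<^bold>\<sim> \<phi>)"
  proof (intro allI impI)
    fix V :: "'v \<Rightarrow> nat \<Rightarrow> bool" and w
    assume V: "persistent fence V"
      and \<Gamma>: "\<forall>\<gamma>\<in>\<Gamma>. \<forall>v. v \<le> w + (n + 2) \<longrightarrow> w \<le> v + (n + 2) \<longrightarrow> sat fence V v \<gamma>"
    \<comment> \<open>The implication goes up to \<open>j\<close>, the exclusion down to
      \<open>k\<close>: at most one step each, hence the extra 2 in the radius.\<close>
    have "sat fence V k \<phi>" if "fence w j" "fence k j" for j k
    proof -
      have "k \<le> w + 2" "w \<le> k + 2"
        using fence_dist[OF that(1)] fence_dist[OF that(2)] by linarith+
      then have "\<forall>\<gamma>\<in>\<Gamma>. \<forall>v. v \<le> k + n \<longrightarrow> k \<le> v + n \<longrightarrow> sat fence V v \<gamma>"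
        using \<Gamma> by auto
      then show ?thesis using n V by blast
    qed
    then show "sat fence V w (\<^bold>\<not> \<^bold>\<sim> \<phi>)" by auto
  qed
  then show ?case ..
qed

lemma sBIL_sound_fence:
  assumes "{} \<turnstile>\<^sub>s \<phi>" "persistent fence V"
  shows "sat fence V w \<phi>"
  using sBIL_local_on_fence[OF assms(1)] assms(2) by simp

abbreviation DN :: "'v fm \<Rightarrow> 'v fm" where
  "DN \<phi> \<equiv> \<^bold>\<not> \<^bold>\<sim> \<phi>"

lemma sBIL_DN_funpow: "\<Gamma> \<turnstile>\<^sub>s \<phi> \<Longrightarrow> \<Gamma> \<turnstile>\<^sub>s (DN ^^ m) \<phi>"
  by (induction m) (auto intro: sDN)

text \<open>From an even point, up one edge and down the next leads two points to the right, so each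
  \<open>DN\<close> carries the claim there.\<close>

lemma sat_DN_funpow_fence:
  "even i \<Longrightarrow> sat fence V i ((DN ^^ m) \<phi>) \<Longrightarrow> sat fence V (i + 2 * m) \<phi>"
proof (induction m arbitrary: i)
  case (Suc m)
  have "fence i (i + 1)" "fence (i + 2) (i + 1)"
    using Suc.prems(1) by (auto simp: fence_def)
  then have "sat fence V (i + 2) ((DN ^^ m) \<phi>)"
    using Suc.prems(2) by auto
  then show ?case
    using Suc.IH[of "i + 2"] Suc.prems(1) by simp
qed simp

theorem mainTheorem10:
  fixes p q :: "'v :: {countable, infinite}"
  assumes "p \<noteq> q"
  shows "\<not> (\<exists>I :: 'v fm set. (\<forall>\<chi> \<in> I. vars \<chi> \<subseteq> {p, q}) \<and>
      (\<forall>(\<Gamma> :: 'v fm set) \<phi> \<psi>.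
        \<Gamma> \<union> {\<phi>} \<turnstile>\<^sub>s \<psi> \<longleftrightarrow> (\<forall>\<chi> \<in> I. \<Gamma> \<turnstile>\<^sub>s subst (Var(p := \<phi>, q := \<psi>)) \<chi>)))"
proof
  assume "\<exists>I :: 'v fm set. (\<forall>\<chi> \<in> I. vars \<chi> \<subseteq> {p, q}) \<and>
      (\<forall>(\<Gamma> :: 'v fm set) \<phi> \<psi>.
        \<Gamma> \<union> {\<phi>} \<turnstile>\<^sub>s \<psi> \<longleftrightarrow> (\<forall>\<chi> \<in> I. \<Gamma> \<turnstile>\<^sub>s subst (Var(p := \<phi>, q := \<psi>)) \<chi>))"
  then obtain I :: "'v fm set" where ddt: "\<And>\<Gamma> \<phi> \<psi>. \<Gamma> \<union> {\<phi>} \<turnstile>\<^sub>s \<psi> \<longleftrightarrow>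
      (\<forall>\<chi> \<in> I. \<Gamma> \<turnstile>\<^sub>s subst (Var(p := \<phi>, q := \<psi>)) \<chi>)"
    by blast
  have subst_Var: "subst Var \<chi> = \<chi>" for \<chi> :: "'v fm"
    by (induction \<chi>) auto
  \<comment> \<open>Detachment: take \<Gamma> to be \<open>I\<close> itself, under the identity
    substitution.\<close>
  have "I \<union> {Var p} \<turnstile>\<^sub>s Var q"
    unfolding ddt by (auto simp: subst_Var intro: El)
  \<comment> \<open>The lower bound of the ball is dropped; it is void at the point 0 used
    below.\<close>
  from sBIL_local_on_fence[OF this] obtain n where
    n: "\<And>V w. persistent fence V \<Longrightarrow>
      (\<And>\<gamma> v. \<gamma> \<in> I \<union> {Var p} \<Longrightarrow> v \<le> w + n \<Longrightarrow> sat fence V v \<gamma>) \<Longrightarrow> sat fence V w (Var q)"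
    by meson
  \<comment> \<open>With \<open>n + 1\<close> iterations, \<open>\<psi>\<close> at 0 forces
    \<open>p\<close> at \<open>2 * n + 2\<close>, the first point where \<open>V\<close> makes it
    false. The cut-off \<open>2 * n + 1\<close> is odd, so the truth set is closed upwards.\<close>
  define \<psi> where "\<psi> = (DN ^^ (n + 1)) (Var p)"
  define \<sigma> where "\<sigma> = Var(p := Var p, q := \<psi>)"
  define V :: "'v \<Rightarrow> nat \<Rightarrow> bool" where "V = (\<lambda>x i. i \<le> 2 * n + 1)"
  define V' where "V' = (\<lambda>x v. sat fence V v (\<sigma> x))"
  have V: "persistent fence V"
    unfolding persistent_def fence_def V_def by (auto elim!: evenE)
  have V': "persistent fence V'"
    unfolding V'_def using persistent_subst[OF transp_fence V] .
  have "{} \<union> {Var p} \<turnstile>\<^sub>s \<psi>"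
    unfolding \<psi>_def by (intro sBIL_DN_funpow El) simp
  then have "\<forall>\<chi> \<in> I. {} \<turnstile>\<^sub>s subst \<sigma> \<chi>"
    unfolding ddt \<sigma>_def .
  \<comment> \<open>The instances under \<open>\<sigma>\<close> are theorems, so they hold
    everywhere under \<open>V\<close>; reading \<open>q\<close> as \<open>\<psi>\<close> turns this
    into truth of \<open>I\<close> under \<open>V'\<close>.\<close>
  then have "sat fence V' v \<chi>" if "\<chi> \<in> I" for \<chi> v
    using that sBIL_sound_fence[OF _ V] unfolding V'_def sat_subst[symmetric] by blast
  moreover have "sat fence V' v (Var p)" if "v \<le> 0 + n" for v
    using that assms by (simp add: V'_def \<sigma>_def V_def)
  ultimately have "sat fence V' 0 (Var q)"
    using n[OF V', of 0] by blast
  then have "sat fence V 0 \<psi>"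
    by (simp add: V'_def \<sigma>_def)
  then have "sat fence V (0 + 2 * (n + 1)) (Var p)"
    unfolding \<psi>_def by (intro sat_DN_funpow_fence) simp_all
  then show False
    by (simp add: V_def)
qed

end
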